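(* Let $s$ be a generalized $n$-series over a commutative ring $R$, and let $R\langle x\rangle_s$ denote the ring $R\bigl[x,\frac{x^n}{n!_s}\bigr]_{n\ge 0}$. Then the cohomology of the complex $s\Omega_{\mathbf{A}^1}\otimes_{R[x]}R\langle x\rangle_s$, i.e. of $\nabla_s:R\langle x\rangle_s\to R\langle x\rangle_s\,dx$, is concentrated in degree zero, where it is isomorphic to $R$.
   Context: A generalized $n$-series over $R$ is a function $s:\mathbf{Z}_{\ge 0}\to R$ with $s(0)=0$, $s(n)$ not a zero-divisor for any $n>0$, and $s(n-k)\mid s(n)-s(k)$ for all $n>k>0$. $n!_s=\prod_{i=1}^ns(i)$. The ring $R\langle x\rangle_s$ is a subring of $R[1/s][x]$, where $R[1/s]=R[s(1)^{-1},s(2)^{-1},\dots]$. The $s$-de Rham complex of $\mathbf{A}^1=\mathrm{Spec}\,R[x]$ is the two-term complex (degrees $0,1$) $s\Omega_{\mathbf{A}^1}=(R[x]\xrightarrow{\nabla_s}R[x]\,dx)$ with $\nabla_s$ the $R$-linear map $x^n\mapsto s(n)x^{n-1}dx$; on $R\langle x\rangle_s$ it is given by the same formula, so $\nabla_s\frac{x^n}{n!_s}=\frac{x^{n-1}}{(n-1)!_s}dx$ for $n\geq 1$. *)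

theory Defs
  imports "HOL-Algebra.UnivPoly" "HOL-Algebra.Generated_Rings" "HOL-Algebra.Divisibility"
begin

(* otherwise it shadows the record field mult of monoids *)
hide_const (open) Multiset.mult

section \<open>Generalized $n$-series\<close>

text \<open>
  The zero ring is allowed, as in \<open>cring\<close>. The condition \<open>s_regular\<close> says that
  \<open>s n\<close> is not a zero-divisor, i.e. that multiplication by \<open>s n\<close> is injective.
\<close>

locale generalized_n_series = cring R for R (structure) +
  fixes s :: "nat \<Rightarrow> 'a"
  assumes s_closed: "s n \<in> carrier R"
    and s_zero: "s 0 = \<zero>"
    and s_regular: "\<lbrakk>0 < n; a \<in> carrier R; a \<otimes> s n = \<zero>\<rbrakk> \<Longrightarrow> a = \<zero>"
    and s_divides_diff: "\<lbrakk>0 < k; k < n\<rbrakk> \<Longrightarrow> s (n - k) divides (s n \<ominus> s k)"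

definition s_fact :: "('a, 'm) ring_scheme \<Rightarrow> (nat \<Rightarrow> 'a) \<Rightarrow> nat \<Rightarrow> 'a"
  where "s_fact R s n = (\<Otimes>\<^bsub>R\<^esub>i\<in>{1..n}. s i)"


section \<open>Localization of a commutative ring\<close>

definition loc_rel :: "('a, 'm) ring_scheme \<Rightarrow> 'a set \<Rightarrow> (('a \<times> 'a) \<times> ('a \<times> 'a)) set"
  where "loc_rel R S =
    {((a, u), (b, v)). a \<in> carrier R \<and> u \<in> S \<and> b \<in> carrier R \<and> v \<in> S \<and>
       (\<exists>w\<in>S. w \<otimes>\<^bsub>R\<^esub> (a \<otimes>\<^bsub>R\<^esub> v \<ominus>\<^bsub>R\<^esub> b \<otimes>\<^bsub>R\<^esub> u) = \<zero>\<^bsub>R\<^esub>)}"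

definition loc_frac :: "('a, 'm) ring_scheme \<Rightarrow> 'a set \<Rightarrow> 'a \<Rightarrow> 'a \<Rightarrow> ('a \<times> 'a) set"
  where "loc_frac R S a u = loc_rel R S `` {(a, u)}"

definition localization :: "('a, 'm) ring_scheme \<Rightarrow> 'a set \<Rightarrow> ('a \<times> 'a) set ring"
  where "localization R S = \<lparr>
    carrier = (carrier R \<times> S) // loc_rel R S,
    mult = (\<lambda>A B. \<Union>(a, u)\<in>A. \<Union>(b, v)\<in>B. loc_frac R S (a \<otimes>\<^bsub>R\<^esub> b) (u \<otimes>\<^bsub>R\<^esub> v)),
    one = loc_frac R S \<one>\<^bsub>R\<^esub> \<one>\<^bsub>R\<^esub>,
    zero = loc_frac R S \<zero>\<^bsub>R\<^esub> \<one>\<^bsub>R\<^esub>,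
    add = (\<lambda>A B. \<Union>(a, u)\<in>A. \<Union>(b, v)\<in>B.
      loc_frac R S (a \<otimes>\<^bsub>R\<^esub> v \<oplus>\<^bsub>R\<^esub> b \<otimes>\<^bsub>R\<^esub> u) (u \<otimes>\<^bsub>R\<^esub> v))\<rparr>"

inductive_set generate_submonoid :: "('a, 'm) monoid_scheme \<Rightarrow> 'a set \<Rightarrow> 'a set"
  for G and H where
    one: "\<one>\<^bsub>G\<^esub> \<in> generate_submonoid G H"
  | incl: "h \<in> H \<Longrightarrow> h \<in> generate_submonoid G H"
  | mult: "\<lbrakk>g \<in> generate_submonoid G H; h \<in> generate_submonoid G H\<rbrakk>
      \<Longrightarrow> g \<otimes>\<^bsub>G\<^esub> h \<in> generate_submonoid G H"

text \<open>
  $R[1/s] = R[s(1)^{-1}, s(2)^{-1}, \ldots]$ is the localization of $R$ at the multiplicative set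
  generated by the $s(n)$ with $n > 0$.
\<close>

abbreviation s_denoms :: "('a, 'm) ring_scheme \<Rightarrow> (nat \<Rightarrow> 'a) \<Rightarrow> 'a set"
  where "s_denoms R s \<equiv> generate_submonoid R (s ` {1..})"

definition s_loc :: "('a, 'm) ring_scheme \<Rightarrow> (nat \<Rightarrow> 'a) \<Rightarrow> ('a \<times> 'a) set ring"
  where "s_loc R s = localization R (s_denoms R s)"

definition s_loc_map :: "('a, 'm) ring_scheme \<Rightarrow> (nat \<Rightarrow> 'a) \<Rightarrow> 'a \<Rightarrow> ('a \<times> 'a) set"
  where "s_loc_map R s a = loc_frac R (s_denoms R s) a \<one>\<^bsub>R\<^esub>"


section \<open>The ring $R\langle x\rangle_s$ and the operator $\nabla_s$\<close>

text \<open>$R\langle x\rangle_s = R[x, x^n/n!_s]_{n \ge 0}$, as a subring of $R[1/s][x]$.\<close>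

definition s_divided_ring :: "('a, 'm) ring_scheme \<Rightarrow> (nat \<Rightarrow> 'a) \<Rightarrow> (nat \<Rightarrow> ('a \<times> 'a) set) set"
  where "s_divided_ring R s =
    generate_ring (UP (s_loc R s))
      ((\<lambda>r. monom (UP (s_loc R s)) (s_loc_map R s r) 0) ` carrier R
       \<union> {monom (UP (s_loc R s)) \<one>\<^bsub>s_loc R s\<^esub> 1}
       \<union> range (\<lambda>n. monom (UP (s_loc R s)) (inv\<^bsub>s_loc R s\<^esub> (s_loc_map R s (s_fact R s n))) n))"

text \<open>
  The linear extension of $x^n \mapsto s(n) x^{n-1}$ to $R[1/s][x]$. The truncated \<open>0 - 1\<close> is
  harmless because $s(0) = 0$.
\<close>

definition s_nabla ::
    "('a, 'm) ring_scheme \<Rightarrow> (nat \<Rightarrow> 'a) \<Rightarrow> (nat \<Rightarrow> ('a \<times> 'a) set) \<Rightarrow> (nat \<Rightarrow> ('a \<times> 'a) set)"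
  where "s_nabla R s p =
    (\<Oplus>\<^bsub>UP (s_loc R s)\<^esub>n\<in>{..deg (s_loc R s) p}.
       monom (UP (s_loc R s)) (coeff (UP (s_loc R s)) p n \<otimes>\<^bsub>s_loc R s\<^esub> s_loc_map R s (s n)) (n - 1))"


section \<open>Cochain complexes of modules and their cohomology\<close>

definition linear_maps ::
    "('a, 'm) ring_scheme \<Rightarrow> ('a, 'b, 'n) module_scheme \<Rightarrow> ('a, 'c, 'p) module_scheme \<Rightarrow> ('b \<Rightarrow> 'c) set"
  where "linear_maps R M N =
    {f \<in> carrier M \<rightarrow> carrier N.
       (\<forall>x\<in>carrier M. \<forall>y\<in>carrier M. f (x \<oplus>\<^bsub>M\<^esub> y) = f x \<oplus>\<^bsub>N\<^esub> f y) \<and>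
       (\<forall>r\<in>carrier R. \<forall>x\<in>carrier M. f (r \<odot>\<^bsub>M\<^esub> x) = r \<odot>\<^bsub>N\<^esub> f x)}"

definition module_isomorphic ::
    "('a, 'm) ring_scheme \<Rightarrow> ('a, 'b, 'n) module_scheme \<Rightarrow> ('a, 'c, 'p) module_scheme \<Rightarrow> bool"
  where "module_isomorphic R M N \<longleftrightarrow>
    (\<exists>f\<in>linear_maps R M N. bij_betw f (carrier M) (carrier N))"

text \<open>
  The library's module record extends the ring record; the \<open>mult\<close> and \<open>one\<close> fields of a mere
  module play no role and are left unspecified in a quotient.
\<close>

definition quotient_module ::
    "('a, 'b, 'n) module_scheme \<Rightarrow> 'b set \<Rightarrow> ('a, 'b set) module"
  where "quotient_module M N = \<lparr>
    carrier = a_rcosets\<^bsub>M\<^esub> N,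
    mult = undefined, one = undefined,
    zero = N,
    add = (\<lambda>A B. A <+>\<^bsub>M\<^esub> B),
    smult = (\<lambda>r A. \<Union>x\<in>A. N +>\<^bsub>M\<^esub> (r \<odot>\<^bsub>M\<^esub> x))\<rparr>"

definition regular_module :: "('a, 'm) ring_scheme \<Rightarrow> ('a, 'a) module"
  where "regular_module R = \<lparr>
    carrier = carrier R, mult = mult R, one = one R, zero = zero R, add = add R, smult = mult R\<rparr>"

definition cochain_complex ::
    "('a, 'm) ring_scheme \<Rightarrow> (int \<Rightarrow> ('a, 'b) module) \<Rightarrow> (int \<Rightarrow> 'b \<Rightarrow> 'b) \<Rightarrow> bool"
  where "cochain_complex R C d \<longleftrightarrow>
    (\<forall>i. module R (C i)) \<and>
    (\<forall>i. d i \<in> linear_maps R (C i) (C (i + 1))) \<and>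
    (\<forall>i. \<forall>x\<in>carrier (C i). d (i + 1) (d i x) = \<zero>\<^bsub>C (i + 1 + 1)\<^esub>)"

definition cohomology ::
    "(int \<Rightarrow> ('a, 'b) module) \<Rightarrow> (int \<Rightarrow> 'b \<Rightarrow> 'b) \<Rightarrow> int \<Rightarrow> ('a, 'b set) module"
  where "cohomology C d i =
    quotient_module ((C i)\<lparr>carrier := a_kernel (C i) (C (i + 1)) (d i)\<rparr>)
      (d (i - 1) ` carrier (C (i - 1)))"


section \<open>The $s$-de Rham complex of $\mathbf{A}^1$ with coefficients in $R\langle x\rangle_s$\<close>

definition s_divided_module ::
    "('a, 'm) ring_scheme \<Rightarrow> (nat \<Rightarrow> 'a) \<Rightarrow> ('a, nat \<Rightarrow> ('a \<times> 'a) set) module"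
  where "s_divided_module R s = \<lparr>
    carrier = s_divided_ring R s,
    mult = mult (UP (s_loc R s)), one = one (UP (s_loc R s)),
    zero = zero (UP (s_loc R s)), add = add (UP (s_loc R s)),
    smult = (\<lambda>r p. s_loc_map R s r \<odot>\<^bsub>UP (s_loc R s)\<^esub> p)\<rparr>"

text \<open>
  The free rank one module $R\langle x\rangle_s\,dx$ in degree 1 is identified with
  $R\langle x\rangle_s$ by means of its basis vector $dx$.
\<close>

definition s_deRham_obj ::
    "('a, 'm) ring_scheme \<Rightarrow> (nat \<Rightarrow> 'a) \<Rightarrow> int \<Rightarrow> ('a, nat \<Rightarrow> ('a \<times> 'a) set) module"
  where "s_deRham_obj R s i =
    (if i = 0 \<or> i = 1 then s_divided_module R s
     else (s_divided_module R s)\<lparr>carrier := {\<zero>\<^bsub>UP (s_loc R s)\<^esub>}\<rparr>)"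

definition s_deRham_diff ::
    "('a, 'm) ring_scheme \<Rightarrow> (nat \<Rightarrow> 'a) \<Rightarrow> int \<Rightarrow> (nat \<Rightarrow> ('a \<times> 'a) set) \<Rightarrow> (nat \<Rightarrow> ('a \<times> 'a) set)"
  where "s_deRham_diff R s i =
    (if i = 0 then s_nabla R s else (\<lambda>_. \<zero>\<^bsub>UP (s_loc R s)\<^esub>))"

end

theory Submission
  imports Defs
begin

text \<open>
  The ring $R\langle x\rangle_s$ is the free \<open>R\<close>-module on the divided powers $x^n/n!_s$, and $\nabla_s$
  acts on this basis as a shift, $x^{n+1}/(n+1)!_s \mapsto x^n/n!_s$ and $1 \mapsto 0$. A shift is
  surjective, so the cohomology in degree one vanishes, and its kernel consists of the constants,
  which form a copy of \<open>R\<close>.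

  The content lies in the description of $R\langle x\rangle_s$, which is defined as the subring of
  $R[1/s][x]$ generated by the divided powers. The span of the divided powers is closed under
  multiplication exactly when the \<open>s\<close>-binomial coefficients $(n+m)!_s / (n!_s\, m!_s)$ lie in \<open>R\<close>; the
  divisibility $s(n-k) \mid s(n) - s(k)$ supplies a Pascal recursion for them
  (\<open>s_factorial_mult_divides\<close>). From this, \<open>s_divided_ring_eq\<close> characterizes $R\langle x\rangle_s$ by
  the condition that the \<open>n\<close>-th coefficient lies in $\frac{1}{n!_s}R$. The operator $\nabla_s$ multiplies
  the coefficient of $x^{n+1}$ by $s(n+1)$ and moves it to degree \<open>n\<close> (\<open>coeff_s_nabla\<close>), so its image
  and kernel can be read off coefficientwise (\<open>s_nabla_surj\<close>, \<open>s_nabla_kernel\<close>). Here all $s(n)$ with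
  $n > 0$ are units of $R[1/s]$, and $R \to R[1/s]$ is injective because they are not zero-divisors.
\<close>

section \<open>Localization of a commutative ring at a submonoid\<close>

locale localization_at_submonoid = cring R + submonoid S R for R (structure) and S
begin

abbreviation frac where "frac a u \<equiv> loc_frac R S a u"

lemma den_carrier [simp]: "u \<in> S \<Longrightarrow> u \<in> carrier R"
  using subset by blast

lemma loc_rel_iff:
  "((a, u), (b, v)) \<in> loc_rel R S \<longleftrightarrow>
    a \<in> carrier R \<and> u \<in> S \<and> b \<in> carrier R \<and> v \<in> S \<and> (\<exists>w\<in>S. w \<otimes> (a \<otimes> v \<ominus> b \<otimes> u) = \<zero>)"
  by (simp add: loc_rel_def)

text \<open>
  The factor \<open>w\<close> in the definition of \<open>loc_rel\<close> is what makes the relation transitive: the middle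
  denominator \<open>v\<close> cannot be cancelled, but it can be absorbed into the witness \<open>w \<otimes> x \<otimes> v\<close>.
\<close>

lemma equiv_loc_rel: "equiv (carrier R \<times> S) (loc_rel R S)"
proof (rule equivI)
  show "loc_rel R S \<subseteq> (carrier R \<times> S) \<times> (carrier R \<times> S)"
    by (auto simp: loc_rel_def)
  show "refl_on (carrier R \<times> S) (loc_rel R S)"
    by (auto simp: refl_on_def loc_rel_iff r_right_minus_eq intro!: bexI[of _ \<one>])
  show "sym (loc_rel R S)"
  proof (rule symI, clarify)
    fix a u b v assume "((a, u), (b, v)) \<in> loc_rel R S"
    then obtain w where *: "a \<in> carrier R" "u \<in> S" "b \<in> carrier R" "v \<in> S" "w \<in> S"
      "w \<otimes> (a \<otimes> v \<ominus> b \<otimes> u) = \<zero>" by (auto simp: loc_rel_iff)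
    have "w \<otimes> (b \<otimes> u \<ominus> a \<otimes> v) \<oplus> w \<otimes> (a \<otimes> v \<ominus> b \<otimes> u) = \<zero>"
      using *(1-5) subset[THEN subsetD] by algebra 
    then show "((b, v), (a, u)) \<in> loc_rel R S"
      using * by (auto simp: loc_rel_iff)
  qed
  show "trans (loc_rel R S)"
  proof (rule transI, clarify)
    fix a u b v c t
    assume "((a, u), (b, v)) \<in> loc_rel R S" "((b, v), (c, t)) \<in> loc_rel R S"
    then obtain w x where *: "a \<in> carrier R" "u \<in> S" "b \<in> carrier R" "v \<in> S"
        "c \<in> carrier R" "t \<in> S" "w \<in> S" "x \<in> S"
      and e: "w \<otimes> (a \<otimes> v \<ominus> b \<otimes> u) = \<zero>" "x \<otimes> (b \<otimes> t \<ominus> c \<otimes> v) = \<zero>"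
      by (auto simp: loc_rel_iff)
    have "(w \<otimes> x \<otimes> v) \<otimes> (a \<otimes> t \<ominus> c \<otimes> u)
        = (x \<otimes> t) \<otimes> (w \<otimes> (a \<otimes> v \<ominus> b \<otimes> u)) \<oplus> (w \<otimes> u) \<otimes> (x \<otimes> (b \<otimes> t \<ominus> c \<otimes> v))"
      using *(1-8) subset[THEN subsetD] by algebra
    then show "((a, u), (c, t)) \<in> loc_rel R S"
      using * e by (auto simp: loc_rel_iff intro!: bexI[of _ "w \<otimes> x \<otimes> v"])
  qed
qed

lemma frac_eq_iff:
  assumes "a \<in> carrier R" "u \<in> S" "b \<in> carrier R" "v \<in> S"
  shows "frac a u = frac b v \<longleftrightarrow> (\<exists>w\<in>S. w \<otimes> (a \<otimes> v \<ominus> b \<otimes> u) = \<zero>)"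
  using equiv_class_eq_iff[OF equiv_loc_rel, of "(a, u)" "(b, v)"] assms
  by (simp add: loc_rel_iff loc_frac_def)

lemma frac_eqI:
  assumes "a \<in> carrier R" "u \<in> S" "b \<in> carrier R" "v \<in> S" "a \<otimes> v = b \<otimes> u"
  shows "frac a u = frac b v"
  using assms by (auto simp: frac_eq_iff r_right_minus_eq intro!: bexI[of _ \<one>])

lemma frac_carrier [simp]:
  "\<lbrakk>a \<in> carrier R; u \<in> S\<rbrakk> \<Longrightarrow> frac a u \<in> carrier (localization R S)"
  by (auto simp: loc_frac_def localization_def intro: quotientI)

lemma localization_cases:
  assumes "A \<in> carrier (localization R S)"
  obtains a u where "a \<in> carrier R" "u \<in> S" "A = frac a u"
  using assms by (auto simp: loc_frac_def localization_def elim: quotientE)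

text \<open>
  The product and the sum of fractions, as defined by unions over representatives, are computed on
  any choice of representatives. In both cases the difference of the two cross products is a
  combination of the given differences, so the product of the two witnesses is a witness.
\<close>

lemma frac_mult_congruent:
  "(\<lambda>(a, u) (b, v). frac (a \<otimes> b) (u \<otimes> v)) respects2 loc_rel R S"
proof (rule congruent2I', clarify)
  fix a u b v a' u' b' v'
  assume "((a, u), (b, v)) \<in> loc_rel R S" "((a', u'), (b', v')) \<in> loc_rel R S"
  then obtain w x where *: "a \<in> carrier R" "u \<in> S" "b \<in> carrier R" "v \<in> S"
      "a' \<in> carrier R" "u' \<in> S" "b' \<in> carrier R" "v' \<in> S" "w \<in> S" "x \<in> S"
    and e: "w \<otimes> (a \<otimes> v \<ominus> b \<otimes> u) = \<zero>" "x \<otimes> (a' \<otimes> v' \<ominus> b' \<otimes> u') = \<zero>"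
    by (auto simp: loc_rel_iff)
  have "(w \<otimes> x) \<otimes> ((a \<otimes> a') \<otimes> (v \<otimes> v') \<ominus> (b \<otimes> b') \<otimes> (u \<otimes> u'))
      = (x \<otimes> a' \<otimes> v') \<otimes> (w \<otimes> (a \<otimes> v \<ominus> b \<otimes> u)) \<oplus> (w \<otimes> b \<otimes> u) \<otimes> (x \<otimes> (a' \<otimes> v' \<ominus> b' \<otimes> u'))"
    using * subset[THEN subsetD] by algebra
  then show "frac (a \<otimes> a') (u \<otimes> u') = frac (b \<otimes> b') (v \<otimes> v')"
    using * e by (auto simp: frac_eq_iff intro!: bexI[of _ "w \<otimes> x"])
qed

lemma localization_mult:
  assumes "a \<in> carrier R" "u \<in> S" "b \<in> carrier R" "v \<in> S"
  shows "frac a u \<otimes>\<^bsub>localization R S\<^esub> frac b v = frac (a \<otimes> b) (u \<otimes> v)"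
  using UN_equiv_class2[OF equiv_loc_rel equiv_loc_rel frac_mult_congruent, of "(a, u)" "(b, v)"] assms
  by (simp add: localization_def loc_frac_def[of R S a] loc_frac_def[of R S b]
      case_prod_unfold)

lemma frac_add_congruent:
  "(\<lambda>(a, u) (b, v). frac (a \<otimes> v \<oplus> b \<otimes> u) (u \<otimes> v)) respects2 loc_rel R S"
proof (rule congruent2I', clarify)
  fix a u b v a' u' b' v'
  assume "((a, u), (b, v)) \<in> loc_rel R S" "((a', u'), (b', v')) \<in> loc_rel R S"
  then obtain w x where *: "a \<in> carrier R" "u \<in> S" "b \<in> carrier R" "v \<in> S"
      "a' \<in> carrier R" "u' \<in> S" "b' \<in> carrier R" "v' \<in> S" "w \<in> S" "x \<in> S"
    and e: "w \<otimes> (a \<otimes> v \<ominus> b \<otimes> u) = \<zero>" "x \<otimes> (a' \<otimes> v' \<ominus> b' \<otimes> u') = \<zero>"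
    by (auto simp: loc_rel_iff)
  have "(w \<otimes> x) \<otimes> ((a \<otimes> u' \<oplus> a' \<otimes> u) \<otimes> (v \<otimes> v') \<ominus> (b \<otimes> v' \<oplus> b' \<otimes> v) \<otimes> (u \<otimes> u'))
      = (x \<otimes> u' \<otimes> v') \<otimes> (w \<otimes> (a \<otimes> v \<ominus> b \<otimes> u)) \<oplus> (w \<otimes> u \<otimes> v) \<otimes> (x \<otimes> (a' \<otimes> v' \<ominus> b' \<otimes> u'))"
    using * subset[THEN subsetD] by algebra
  then show "frac (a \<otimes> u' \<oplus> a' \<otimes> u) (u \<otimes> u') = frac (b \<otimes> v' \<oplus> b' \<otimes> v) (v \<otimes> v')"
    using * e by (auto simp: frac_eq_iff intro!: bexI[of _ "w \<otimes> x"])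
qed

lemma localization_add:
  assumes "a \<in> carrier R" "u \<in> S" "b \<in> carrier R" "v \<in> S"
  shows "frac a u \<oplus>\<^bsub>localization R S\<^esub> frac b v = frac (a \<otimes> v \<oplus> b \<otimes> u) (u \<otimes> v)"
  using UN_equiv_class2[OF equiv_loc_rel equiv_loc_rel frac_add_congruent, of "(a, u)" "(b, v)"] assms
  by (simp add: localization_def loc_frac_def[of R S a] loc_frac_def[of R S b]
      case_prod_unfold)

lemma localization_one: "\<one>\<^bsub>localization R S\<^esub> = frac \<one> \<one>"
  and localization_zero: "\<zero>\<^bsub>localization R S\<^esub> = frac \<zero> \<one>"
  by (simp_all add: localization_def)

lemmas localization_ops =
  localization_mult localization_add localization_one localization_zero

text \<open>
  Each ring axiom reduces to an identity of cross products in \<open>R\<close> itself, with the witness \<open>\<one>\<close>.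
\<close>

lemma cring_localization: "cring (localization R S)"
proof (rule cringI)
  show "abelian_group (localization R S)"
  proof (rule abelian_groupI)
    fix A assume "A \<in> carrier (localization R S)"
    then obtain a u where A: "a \<in> carrier R" "u \<in> S" "A = frac a u" by (rule localization_cases)
    show "\<exists>B\<in>carrier (localization R S). B \<oplus>\<^bsub>localization R S\<^esub> A = \<zero>\<^bsub>localization R S\<^esub>"
      using A by (intro bexI[of _ "frac (\<ominus> a) u"])
        (simp_all add: localization_ops l_minus l_neg, rule frac_eqI, simp_all)
    show "\<zero>\<^bsub>localization R S\<^esub> \<oplus>\<^bsub>localization R S\<^esub> A = A"
      using A by (simp add: localization_ops)
  next
    fix A B assume AB: "A \<in> carrier (localization R S)" "B \<in> carrier (localization R S)"
    obtain a u where a: "a \<in> carrier R" "u \<in> S" "A = frac a u"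
      using AB(1) by (rule localization_cases)
    obtain b v where b: "b \<in> carrier R" "v \<in> S" "B = frac b v"
      using AB(2) by (rule localization_cases)
    note A = a b
    show "A \<oplus>\<^bsub>localization R S\<^esub> B \<in> carrier (localization R S)"
      using A by (simp add: localization_ops)
    show "A \<oplus>\<^bsub>localization R S\<^esub> B = B \<oplus>\<^bsub>localization R S\<^esub> A"
      using A by (simp add: localization_ops a_comm m_comm)
    fix C assume "C \<in> carrier (localization R S)"
    then obtain c t where C: "c \<in> carrier R" "t \<in> S" "C = frac c t" by (rule localization_cases)
    have eq: "((a \<otimes> v \<oplus> b \<otimes> u) \<otimes> t \<oplus> c \<otimes> (u \<otimes> v)) \<otimes> (u \<otimes> (v \<otimes> t))
        = (a \<otimes> (v \<otimes> t) \<oplus> (b \<otimes> t \<oplus> c \<otimes> v) \<otimes> u) \<otimes> ((u \<otimes> v) \<otimes> t)"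
      using A(1,2,4,5) C(1,2) subset[THEN subsetD] by algebra
    show "A \<oplus>\<^bsub>localization R S\<^esub> B \<oplus>\<^bsub>localization R S\<^esub> C = A \<oplus>\<^bsub>localization R S\<^esub> (B \<oplus>\<^bsub>localization R S\<^esub> C)"
      using A C by (simp add: localization_ops) (rule frac_eqI; (rule eq | simp))
  qed (simp add: localization_ops)
  show "comm_monoid (localization R S)"
  proof (rule comm_monoidI)
    fix A assume "A \<in> carrier (localization R S)"
    then obtain a u where A: "a \<in> carrier R" "u \<in> S" "A = frac a u" by (rule localization_cases)
    show "\<one>\<^bsub>localization R S\<^esub> \<otimes>\<^bsub>localization R S\<^esub> A = A"
      using A by (simp add: localization_ops)
  next
    fix A B assume AB: "A \<in> carrier (localization R S)" "B \<in> carrier (localization R S)"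
    obtain a u where a: "a \<in> carrier R" "u \<in> S" "A = frac a u"
      using AB(1) by (rule localization_cases)
    obtain b v where b: "b \<in> carrier R" "v \<in> S" "B = frac b v"
      using AB(2) by (rule localization_cases)
    note A = a b
    show "A \<otimes>\<^bsub>localization R S\<^esub> B \<in> carrier (localization R S)"
      using A by (simp add: localization_ops)
    show "A \<otimes>\<^bsub>localization R S\<^esub> B = B \<otimes>\<^bsub>localization R S\<^esub> A"
      using A by (simp add: localization_ops m_comm)
    fix C assume "C \<in> carrier (localization R S)"
    then obtain c t where C: "c \<in> carrier R" "t \<in> S" "C = frac c t" by (rule localization_cases)
    show "A \<otimes>\<^bsub>localization R S\<^esub> B \<otimes>\<^bsub>localization R S\<^esub> C = A \<otimes>\<^bsub>localization R S\<^esub> (B \<otimes>\<^bsub>localization R S\<^esub> C)"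
      using A C by (simp add: localization_ops m_assoc)
  qed (simp add: localization_ops)
next
  fix A B C
  assume ABC: "A \<in> carrier (localization R S)" "B \<in> carrier (localization R S)"
    "C \<in> carrier (localization R S)"
  obtain a u where a: "a \<in> carrier R" "u \<in> S" "A = frac a u"
    using ABC(1) by (rule localization_cases)
  obtain b v where b: "b \<in> carrier R" "v \<in> S" "B = frac b v"
    using ABC(2) by (rule localization_cases)
  obtain c t where c: "c \<in> carrier R" "t \<in> S" "C = frac c t"
    using ABC(3) by (rule localization_cases)
  note A = a b c
  have eq: "((a \<otimes> v \<oplus> b \<otimes> u) \<otimes> c) \<otimes> ((u \<otimes> t) \<otimes> (v \<otimes> t))
      = ((a \<otimes> c) \<otimes> (v \<otimes> t) \<oplus> (b \<otimes> c) \<otimes> (u \<otimes> t)) \<otimes> ((u \<otimes> v) \<otimes> t)"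
    using A(1,2,4,5,7,8) subset[THEN subsetD] by algebra
  show "(A \<oplus>\<^bsub>localization R S\<^esub> B) \<otimes>\<^bsub>localization R S\<^esub> C
      = A \<otimes>\<^bsub>localization R S\<^esub> C \<oplus>\<^bsub>localization R S\<^esub> B \<otimes>\<^bsub>localization R S\<^esub> C"
    using A by (simp add: localization_ops) (rule frac_eqI; (rule eq | simp))
qed

lemma frac_hom: "(\<lambda>a. frac a \<one>) \<in> ring_hom R (localization R S)"
  by (rule ring_hom_memI) (simp_all add: localization_ops)

lemma frac_Units:
  assumes "u \<in> S"
  shows "frac u \<one> \<in> Units (localization R S)"
proof -
  interpret localization: cring "localization R S"
    by (rule cring_localization)
  have "frac \<one> u \<otimes>\<^bsub>localization R S\<^esub> frac u \<one> = \<one>\<^bsub>localization R S\<^esub>"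
    using assms by (simp add: localization_ops) (rule frac_eqI; simp)
  then show ?thesis
    using assms localization.m_comm[of "frac \<one> u" "frac u \<one>"]
    by (auto simp: Units_def intro!: bexI[of _ "frac \<one> u"])
qed

lemma inj_on_frac:
  assumes regular: "\<And>w a. \<lbrakk>w \<in> S; a \<in> carrier R; w \<otimes> a = \<zero>\<rbrakk> \<Longrightarrow> a = \<zero>"
  shows "inj_on (\<lambda>a. frac a \<one>) (carrier R)"
proof (rule inj_onI)
  fix a b assume "a \<in> carrier R" "b \<in> carrier R" "frac a \<one> = frac b \<one>"
  then have "a \<ominus> b = \<zero>"
    using regular by (auto simp: frac_eq_iff simp del: r_right_minus_eq)
  then show "a = b"
    using \<open>a \<in> carrier R\<close> \<open>b \<in> carrier R\<close> by simp
qed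

end

section \<open>Factorials and binomial coefficients of a generalized $n$-series\<close>

context generalized_n_series begin

lemma s_denoms_submonoid: "submonoid (s_denoms R s) R"
proof (rule submonoid.intro)
  show "s_denoms R s \<subseteq> carrier R"
  proof
    fix u assume "u \<in> s_denoms R s"
    then show "u \<in> carrier R"
      by induction (auto intro: s_closed)
  qed
qed (auto intro: generate_submonoid.intros)

sublocale denoms: localization_at_submonoid R "s_denoms R s"
  by (rule localization_at_submonoid.intro[OF cring_axioms s_denoms_submonoid])

text \<open>
  A product of elements that are not zero-divisors is not a zero-divisor. With \<open>inj_on_frac\<close>, this
  is why \<open>R\<close> embeds into $R[1/s]$, so that $H^0$ is \<open>R\<close> itself and not a quotient of it.
\<close>

lemma s_denoms_regular:
  assumes "w \<in> s_denoms R s" "a \<in> carrier R" "w \<otimes> a = \<zero>"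
  shows "a = \<zero>"
  using assms
proof (induction arbitrary: a)
  case (incl h)
  then obtain n where n: "n \<in> {1..}" "h = s n" by blast
  then have "a \<otimes> s n = \<zero>"
    using incl(2,3) s_closed[of n] m_comm[of a "s n"] by simp
  then show ?case
    using incl(2) n(1) by (intro s_regular[of n a]) auto
next
  case (mult g h)
  have closed: "g \<in> carrier R" "h \<in> carrier R"
    using mult.hyps by (auto intro: denoms.den_carrier)
  have "g \<otimes> (h \<otimes> a) = \<zero>"
    using mult.prems closed by (simp flip: m_assoc)
  then have "h \<otimes> a = \<zero>"
    using mult.prems(1) closed by (intro mult.IH(1)[of "h \<otimes> a"]) auto
  then show ?case
    by (rule mult.IH(2)[OF mult.prems(1)])
qed simp

abbreviation L where "L \<equiv> s_loc R s"
abbreviation \<iota> where "\<iota> \<equiv> s_loc_map R s"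
abbreviation P where "P \<equiv> UP (s_loc R s)"
abbreviation s_factorial where "s_factorial n \<equiv> s_fact R s n"

sublocale P: UP_cring "s_loc R s" "UP (s_loc R s)"
  unfolding s_loc_def
  by (rule UP_cring.intro) (rule denoms.cring_localization)

lemma \<iota>_hom: "\<iota> \<in> ring_hom R L"
  using denoms.frac_hom by (simp add: s_loc_def s_loc_map_def[abs_def])

lemmas \<iota>_simps [simp] =
  ring_hom_closed[OF \<iota>_hom] ring_hom_mult[OF \<iota>_hom] ring_hom_add[OF \<iota>_hom] ring_hom_one[OF \<iota>_hom]

lemma \<iota>_zero [simp]: "\<iota> \<zero> = \<zero>\<^bsub>L\<^esub>"
  using denoms.localization_zero by (simp add: s_loc_map_def s_loc_def)

lemma \<iota>_neg: "a \<in> carrier R \<Longrightarrow> \<iota> (\<ominus> a) = \<ominus>\<^bsub>L\<^esub> \<iota> a"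
  by (rule P.R.minus_equality[symmetric]) (simp_all flip: ring_hom_add[OF \<iota>_hom] add: l_neg)

lemma inj_on_\<iota>: "inj_on \<iota> (carrier R)"
  using denoms.inj_on_frac s_denoms_regular by (simp add: s_loc_map_def[abs_def])

lemma \<iota>_Units: "u \<in> s_denoms R s \<Longrightarrow> \<iota> u \<in> Units L"
  using denoms.frac_Units by (simp add: s_loc_def s_loc_map_def)

lemma s_factorial_0 [simp]: "s_factorial 0 = \<one>"
  by (simp add: s_fact_def)

lemma s_factorial_Suc: "s_factorial (Suc n) = s (Suc n) \<otimes> s_factorial n"
proof -
  have "{1..Suc n} = insert (Suc n) {1..n}" by auto
  then show ?thesis
    by (simp add: s_fact_def s_closed)
qed

lemma s_factorial_denom: "s_factorial n \<in> s_denoms R s"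
proof (induction n)
  case (Suc n)
  have "s (Suc n) \<in> s_denoms R s"
    by (rule generate_submonoid.incl) simp
  then show ?case
    using Suc by (simp only: s_factorial_Suc generate_submonoid.mult)
qed (simp only: s_factorial_0 generate_submonoid.one)

lemma s_factorial_closed [simp]: "s_factorial n \<in> carrier R"
  using s_factorial_denom by simp

text \<open>
  The \<open>s\<close>-binomial coefficients lie in \<open>R\<close>. The reason is the divisibility axiom of a
  generalized \<open>n\<close>-series. If $s(n+m) - s(n) = s(m)\,d$, then splitting $s(n+m) = s(m)\,d + s(n)$ in
  $(n+m)!_s = s(n+m)\,(n+m-1)!_s$ gives a Pascal rule
  $\binom{n+m}{n}_s = d\,\binom{n+m-1}{n}_s + \binom{n+m-1}{n-1}_s$, and induction on $n+m$ applies.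
\<close>

lemma s_factorial_mult_divides: "s_factorial n \<otimes> s_factorial m divides s_factorial (n + m)"
proof (induction "n + m" arbitrary: n m rule: less_induct)
  case less
  show ?case
  proof (cases "n = 0 \<or> m = 0")
    case False
    then obtain n' m' where nm: "n = Suc n'" "m = Suc m'"
      by (meson not0_implies_Suc)
    have "s (n + m - n) divides (s (n + m) \<ominus> s n)"
      using nm by (intro s_divides_diff) auto
    then obtain d where d: "d \<in> carrier R" "s (n + m) \<ominus> s n = s m \<otimes> d"
      by (auto simp: factor_def)
    have "s (n + m) = (s (n + m) \<ominus> s n) \<oplus> s n"
      using s_closed by algebra
    then have sd: "s (n + m) = s m \<otimes> d \<oplus> s n"
      by (simp add: d)
    obtain c where c: "c \<in> carrier R"
      "s_factorial (n' + m) = s_factorial n' \<otimes> s_factorial m \<otimes> c"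
      using less[of n' m] nm by (auto simp: factor_def)
    obtain c' where c': "c' \<in> carrier R"
      "s_factorial (n + m') = s_factorial n \<otimes> s_factorial m' \<otimes> c'"
      using less[of n m'] nm by (auto simp: factor_def)
    have "n' + m = n + m'" using nm by simp
    note closed = c(1) c'(1) d(1) s_closed s_factorial_closed
    have "s_factorial (n + m) = s (n + m) \<otimes> s_factorial (n' + m)"
      using s_factorial_Suc[of "n' + m"] nm by simp
    also have "\<dots> = s m \<otimes> d \<otimes> s_factorial (n + m') \<oplus> s n \<otimes> s_factorial (n' + m)"
      unfolding sd \<open>n' + m = n + m'\<close> using closed by algebra
    also have "\<dots> = s m \<otimes> d \<otimes> (s_factorial n \<otimes> s_factorial m' \<otimes> c')
        \<oplus> s n \<otimes> (s_factorial n' \<otimes> s_factorial m \<otimes> c)"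
      by (simp only: c c')
    also have "\<dots> = s_factorial n \<otimes> (s m \<otimes> s_factorial m') \<otimes> (d \<otimes> c')
        \<oplus> (s n \<otimes> s_factorial n') \<otimes> s_factorial m \<otimes> c"
      using closed by algebra
    also have "\<dots> = s_factorial n \<otimes> s_factorial m \<otimes> (d \<otimes> c' \<oplus> c)"
      unfolding nm s_factorial_Suc[symmetric] using closed by algebra
    finally show ?thesis
      using closed by (auto simp: factor_def)
  qed (auto simp: factor_def intro!: bexI[of _ \<one>])
qed

definition inv_fact where "inv_fact n = inv\<^bsub>L\<^esub> (\<iota> (s_factorial n))"

lemma inv_fact_closed [simp]: "inv_fact n \<in> carrier L"
  unfolding inv_fact_def using \<iota>_Units[OF s_factorial_denom] by simp

lemma inv_fact_0 [simp]: "inv_fact 0 = \<one>\<^bsub>L\<^esub>"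
  by (simp add: inv_fact_def)

lemma fact_inv_fact: "\<iota> (s_factorial n) \<otimes>\<^bsub>L\<^esub> inv_fact n = \<one>\<^bsub>L\<^esub>"
  unfolding inv_fact_def using \<iota>_Units[OF s_factorial_denom] by simp

lemma inv_fact_Suc: "inv_fact (Suc n) \<otimes>\<^bsub>L\<^esub> \<iota> (s (Suc n)) = inv_fact n"
proof -
  note closed = inv_fact_closed ring_hom_closed[OF \<iota>_hom s_closed]
    ring_hom_closed[OF \<iota>_hom s_factorial_closed]
  have "inv_fact (Suc n) \<otimes>\<^bsub>L\<^esub> \<iota> (s (Suc n))
      = inv_fact (Suc n) \<otimes>\<^bsub>L\<^esub> \<iota> (s (Suc n)) \<otimes>\<^bsub>L\<^esub> (\<iota> (s_factorial n) \<otimes>\<^bsub>L\<^esub> inv_fact n)"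
    using closed by (simp add: fact_inv_fact)
  also have "\<dots> = (\<iota> (s (Suc n)) \<otimes>\<^bsub>L\<^esub> \<iota> (s_factorial n) \<otimes>\<^bsub>L\<^esub> inv_fact (Suc n)) \<otimes>\<^bsub>L\<^esub> inv_fact n"
    using closed by (simp add: P.R.m_ac)
  also have "\<iota> (s (Suc n)) \<otimes>\<^bsub>L\<^esub> \<iota> (s_factorial n) = \<iota> (s_factorial (Suc n))"
    by (simp add: s_factorial_Suc s_closed)
  finally show ?thesis
    by (simp add: fact_inv_fact)
qed

text \<open>
  The product of $1/n!_s$ and $1/m!_s$ is an \<open>s\<close>-binomial coefficient times $1/(n+m)!_s$.
\<close>

lemma inv_fact_mult:
  obtains c where "c \<in> carrier R" "inv_fact n \<otimes>\<^bsub>L\<^esub> inv_fact m = \<iota> c \<otimes>\<^bsub>L\<^esub> inv_fact (n + m)"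
proof -
  obtain c where c: "c \<in> carrier R" "s_factorial (n + m) = s_factorial n \<otimes> s_factorial m \<otimes> c"
    using s_factorial_mult_divides[of n m] by (auto simp: factor_def)
  have eq: "\<iota> (s_factorial (n + m)) = \<iota> (s_factorial n) \<otimes>\<^bsub>L\<^esub> \<iota> (s_factorial m) \<otimes>\<^bsub>L\<^esub> \<iota> c"
    using c by simp
  note closed = inv_fact_closed ring_hom_closed[OF \<iota>_hom c(1)]
    ring_hom_closed[OF \<iota>_hom s_factorial_closed]
  have "inv_fact n \<otimes>\<^bsub>L\<^esub> inv_fact m
      = inv_fact n \<otimes>\<^bsub>L\<^esub> inv_fact m \<otimes>\<^bsub>L\<^esub> (\<iota> (s_factorial (n + m)) \<otimes>\<^bsub>L\<^esub> inv_fact (n + m))"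
    by (simp add: fact_inv_fact)
  also have "\<dots> = (\<iota> (s_factorial n) \<otimes>\<^bsub>L\<^esub> inv_fact n) \<otimes>\<^bsub>L\<^esub> (\<iota> (s_factorial m) \<otimes>\<^bsub>L\<^esub> inv_fact m)
      \<otimes>\<^bsub>L\<^esub> (\<iota> c \<otimes>\<^bsub>L\<^esub> inv_fact (n + m))"
    unfolding eq using closed by (simp add: P.R.m_ac)
  finally show ?thesis
    using that[OF c(1)] closed by (simp add: fact_inv_fact)
qed

text \<open>
  The \<open>R\<close>-submodule $\frac{1}{n!_s}R$ of $R[1/s]$. These submodules form a multiplicative filtration
  (\<open>inv_fact_span_mult\<close>), which is what makes the polynomials whose \<open>n\<close>-th coefficient lies in the
  \<open>n\<close>-th submodule a ring.
\<close>

definition inv_fact_span where "inv_fact_span n = (\<lambda>r. \<iota> r \<otimes>\<^bsub>L\<^esub> inv_fact n) ` carrier R"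

lemma inv_fact_span_iff: "x \<in> inv_fact_span n \<longleftrightarrow> (\<exists>r\<in>carrier R. x = \<iota> r \<otimes>\<^bsub>L\<^esub> inv_fact n)"
  by (auto simp: inv_fact_span_def)

lemma inv_fact_span_closed: "x \<in> inv_fact_span n \<Longrightarrow> x \<in> carrier L"
  by (auto simp: inv_fact_span_iff)

lemma inv_fact_span_zero: "\<zero>\<^bsub>L\<^esub> \<in> inv_fact_span n"
  by (auto simp: inv_fact_span_iff intro!: bexI[of _ \<zero>])

lemma inv_fact_span_add:
  assumes "x \<in> inv_fact_span n" "y \<in> inv_fact_span n"
  shows "x \<oplus>\<^bsub>L\<^esub> y \<in> inv_fact_span n"
  using assms unfolding inv_fact_span_iff
  by (metis \<iota>_simps(1,3) P.R.l_distr a_closed inv_fact_closed)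

lemma inv_fact_span_neg:
  assumes "x \<in> inv_fact_span n"
  shows "\<ominus>\<^bsub>L\<^esub> x \<in> inv_fact_span n"
  using assms unfolding inv_fact_span_iff
  by (metis \<iota>_simps(1) \<iota>_neg P.R.l_minus a_inv_closed inv_fact_closed)

lemma inv_fact_span_smult:
  assumes "r \<in> carrier R" "x \<in> inv_fact_span n"
  shows "\<iota> r \<otimes>\<^bsub>L\<^esub> x \<in> inv_fact_span n"
  using assms unfolding inv_fact_span_iff
  by (metis \<iota>_simps(1,2) P.R.m_assoc m_closed inv_fact_closed)

lemma inv_fact_span_mult:
  assumes "x \<in> inv_fact_span n" "y \<in> inv_fact_span m"
  shows "x \<otimes>\<^bsub>L\<^esub> y \<in> inv_fact_span (n + m)"
proof -
  obtain a b where ab: "a \<in> carrier R" "b \<in> carrier R"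
    "x = \<iota> a \<otimes>\<^bsub>L\<^esub> inv_fact n" "y = \<iota> b \<otimes>\<^bsub>L\<^esub> inv_fact m"
    using assms by (auto simp: inv_fact_span_iff)
  obtain c where c: "c \<in> carrier R" "inv_fact n \<otimes>\<^bsub>L\<^esub> inv_fact m = \<iota> c \<otimes>\<^bsub>L\<^esub> inv_fact (n + m)"
    by (rule inv_fact_mult)
  have "x \<otimes>\<^bsub>L\<^esub> y = \<iota> a \<otimes>\<^bsub>L\<^esub> \<iota> b \<otimes>\<^bsub>L\<^esub> (inv_fact n \<otimes>\<^bsub>L\<^esub> inv_fact m)"
    using ab by (simp add: P.R.m_ac)
  also have "\<dots> = \<iota> (a \<otimes> b \<otimes> c) \<otimes>\<^bsub>L\<^esub> inv_fact (n + m)"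
    using ab c by (simp add: P.R.m_ac)
  finally show ?thesis
    unfolding inv_fact_span_iff using ab(1,2) c(1) by blast
qed

lemma inv_fact_span_finsum:
  assumes "finite I" "\<And>i. i \<in> I \<Longrightarrow> f i \<in> inv_fact_span n"
  shows "(\<Oplus>\<^bsub>L\<^esub>i\<in>I. f i) \<in> inv_fact_span n"
  using assms
proof (induction I)
  case (insert i I)
  then have "(\<Oplus>\<^bsub>L\<^esub>i\<in>insert i I. f i) = f i \<oplus>\<^bsub>L\<^esub> (\<Oplus>\<^bsub>L\<^esub>i\<in>I. f i)"
    by (intro P.R.finsum_insert) (auto intro: inv_fact_span_closed)
  then show ?case
    using insert by (simp add: inv_fact_span_add)
qed (simp add: inv_fact_span_zero)

lemma one_in_inv_fact_span_0: "\<one>\<^bsub>L\<^esub> \<in> inv_fact_span 0"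
  by (auto simp: inv_fact_span_iff intro!: bexI[of _ \<one>])

end

section \<open>Coefficientwise description of $R\langle x\rangle_s$ and $\nabla_s$\<close>

context generalized_n_series begin

text \<open>
  The ring $R\langle x\rangle_s$ is the free \<open>R\<close>-module on the divided powers $x^n/n!_s$, which turns
  membership into a condition on each coefficient separately. The polynomials satisfying that
  condition form a subring that contains the generators, where $x = s(1) \cdot x^1/1!_s$. Conversely,
  each term of such a polynomial is a constant times one of the generators $x^n/n!_s$.
\<close>

lemma s_divided_ring_eq:
  "s_divided_ring R s = {p \<in> carrier P. \<forall>n. coeff P p n \<in> inv_fact_span n}" (is "_ = ?D")
proof
  define gens where "gens = (\<lambda>r. monom P (\<iota> r) 0) ` carrier R
      \<union> {monom P \<one>\<^bsub>L\<^esub> 1}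
      \<union> range (\<lambda>n. monom P (inv_fact n) n)"
  have ring: "s_divided_ring R s = generate_ring P gens"
    unfolding s_divided_ring_def inv_fact_def gens_def ..
  have gens_closed: "gens \<subseteq> carrier P" by (auto simp: gens_def)
  have inv_fact: "inv_fact n \<in> inv_fact_span n" for n
    by (auto simp: inv_fact_span_iff intro!: bexI[of _ \<one>])
  have const: "\<iota> r \<in> inv_fact_span 0" if "r \<in> carrier R" for r
    using that by (auto simp: inv_fact_span_iff)
  have x: "\<one>\<^bsub>L\<^esub> \<in> inv_fact_span 1"
  proof -
    have "\<iota> (s 1) \<otimes>\<^bsub>L\<^esub> inv_fact 1 = \<one>\<^bsub>L\<^esub>"
      using inv_fact_Suc[of 0] s_closed[of 1] by (simp add: P.R.m_comm)
    then show ?thesis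
      using s_closed by (auto simp: inv_fact_span_iff intro!: bexI[of _ "s 1"])
  qed
  have "subring ?D P"
  proof (rule P.P.subringI)
    fix p q assume pq: "p \<in> ?D" "q \<in> ?D"
    have "coeff P p i \<otimes>\<^bsub>L\<^esub> coeff P q (n - i) \<in> inv_fact_span n" if "i \<le> n" for i n
      using inv_fact_span_mult[of "coeff P p i" i "coeff P q (n - i)" "n - i"] pq that by simp
    then show "p \<otimes>\<^bsub>P\<^esub> q \<in> ?D"
      using pq by (auto intro!: inv_fact_span_finsum)
    show "p \<oplus>\<^bsub>P\<^esub> q \<in> ?D"
      using pq by (auto intro: inv_fact_span_add)
  qed (auto simp: inv_fact_span_zero one_in_inv_fact_span_0 inv_fact_span_neg)
  moreover have "gens \<subseteq> ?D"
    using inv_fact const x by (auto simp: gens_def inv_fact_span_zero)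
  ultimately show "s_divided_ring R s \<subseteq> ?D"
    unfolding ring by (rule P.P.generate_ring_min_subring1[OF gens_closed])
  show "?D \<subseteq> s_divided_ring R s"
  proof
    fix p assume p: "p \<in> ?D"
    have "monom P (coeff P p i) i \<in> generate_ring P gens" for i
    proof -
      obtain r where r: "r \<in> carrier R" "coeff P p i = \<iota> r \<otimes>\<^bsub>L\<^esub> inv_fact i"
        using p by (auto simp: inv_fact_span_iff)
      have "monom P (coeff P p i) i = monom P (\<iota> r) 0 \<otimes>\<^bsub>P\<^esub> monom P (inv_fact i) i"
        using P.monom_mult[of "\<iota> r" "inv_fact i" 0 i] r by simp
      also have "\<dots> \<in> generate_ring P gens"
        using r by (intro generate_ring.eng_mult generate_ring.incl) (auto simp: gens_def)
      finally show ?thesis .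
    qed
    note monom_mem = this
    have term_closed: "monom P (coeff P p i) i \<in> carrier P" for i
      using p by simp
    have "(\<Oplus>\<^bsub>P\<^esub>i\<in>I. monom P (coeff P p i) i) \<in> generate_ring P gens" if "finite I" for I
      using that
    proof (induction I)
      case (insert i I)
      have "(\<Oplus>\<^bsub>P\<^esub>i\<in>insert i I. monom P (coeff P p i) i)
          = monom P (coeff P p i) i \<oplus>\<^bsub>P\<^esub> (\<Oplus>\<^bsub>P\<^esub>i\<in>I. monom P (coeff P p i) i)"
        by (rule P.P.finsum_insert[OF insert.hyps]) (use term_closed in blast)+
      then show ?case
        using generate_ring.eng_add[OF monom_mem insert.IH] by simp
    qed (simp add: P.P.zero_in_generate)
    from this[of "{..deg L p}"] show "p \<in> s_divided_ring R s"
      unfolding ring using P.up_repr[of p] p by simp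
  qed
qed

lemma s_nabla_closed: "p \<in> carrier P \<Longrightarrow> s_nabla R s p \<in> carrier P"
  unfolding s_nabla_def using s_closed by (intro P.P.finsum_closed) auto

text \<open>
  Reading off coefficients: only the term of degree $n+1$ contributes to degree \<open>n\<close>. The terms of
  degree \<open>0\<close> and \<open>1\<close> are both sent to degree \<open>0\<close> by the truncated subtraction, but the first is zero
  because $s(0) = 0$.
\<close>

lemma coeff_s_nabla:
  assumes p: "p \<in> carrier P"
  shows "coeff P (s_nabla R s p) n = coeff P p (Suc n) \<otimes>\<^bsub>L\<^esub> \<iota> (s (Suc n))"
proof -
  let ?t = "\<lambda>k. coeff P p k \<otimes>\<^bsub>L\<^esub> \<iota> (s k)"
  have t_closed: "?t k \<in> carrier L" for k
    using p s_closed by simp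
  have t0: "?t 0 = \<zero>\<^bsub>L\<^esub>"
    using p by (simp add: s_zero)
  have "coeff P (s_nabla R s p) n = (\<Oplus>\<^bsub>L\<^esub>k\<in>{..deg L p}. coeff P (monom P (?t k) (k - 1)) n)"
    unfolding s_nabla_def using t_closed by (intro P.coeff_finsum) auto
  also have "\<dots> = (\<Oplus>\<^bsub>L\<^esub>k\<in>{..deg L p}. if Suc n = k then ?t k else \<zero>\<^bsub>L\<^esub>)"
    using t_closed t0 by (intro P.R.finsum_cong') (auto simp: P.coeff_monom split: nat_diff_split)
  also have "\<dots> = ?t (Suc n)"
  proof (cases "Suc n \<le> deg L p")
    case True
    then show ?thesis
      using t_closed by (intro P.R.finsum_singleton) auto
  next
    case False
    then have "(\<Oplus>\<^bsub>L\<^esub>k\<in>{..deg L p}. if Suc n = k then ?t k else \<zero>\<^bsub>L\<^esub>) = \<zero>\<^bsub>L\<^esub>"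
      by (intro P.R.add.finprod_one_eqI) auto
    moreover have "coeff P p (Suc n) = \<zero>\<^bsub>L\<^esub>"
      using False p by (intro P.deg_aboveD) auto
    ultimately show ?thesis
      using s_closed by simp
  qed
  finally show ?thesis .
qed

abbreviation D where "D \<equiv> s_divided_ring R s"

lemma D_carrier: "p \<in> D \<Longrightarrow> p \<in> carrier P"
  by (simp add: s_divided_ring_eq)

lemma coeff_D: "p \<in> D \<Longrightarrow> coeff P p n \<in> inv_fact_span n"
  by (simp add: s_divided_ring_eq)

text \<open>
  Multiplication by $s(n+1)$ maps $\frac{1}{(n+1)!_s}R$ into $\frac{1}{n!_s}R$.
\<close>

lemma s_nabla_D:
  assumes "p \<in> D"
  shows "s_nabla R s p \<in> D"
proof -
  have "coeff P (s_nabla R s p) n \<in> inv_fact_span n" for n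
  proof -
    obtain r where r: "r \<in> carrier R" "coeff P p (Suc n) = \<iota> r \<otimes>\<^bsub>L\<^esub> inv_fact (Suc n)"
      using coeff_D[OF assms, of "Suc n"] by (auto simp: inv_fact_span_iff)
    have "coeff P (s_nabla R s p) n = \<iota> r \<otimes>\<^bsub>L\<^esub> inv_fact n"
      using assms r s_closed
      by (simp add: coeff_s_nabla D_carrier P.R.m_assoc inv_fact_Suc)
    then show ?thesis
      using r by (auto simp: inv_fact_span_iff)
  qed
  then show ?thesis
    using assms by (simp add: s_divided_ring_eq s_nabla_closed)
qed

lemma \<iota>_s_Units: "\<iota> (s (Suc n)) \<in> Units L"
  by (intro \<iota>_Units generate_submonoid.incl) auto

text \<open>
  Formal integration: dividing the coefficient of $x^n$ by $s(n+1)$ and moving it to degree $n+1$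
  stays inside $R\langle x\rangle_s$, since $\frac{r}{n!_s} \cdot \frac{1}{s(n+1)} = \frac{r}{(n+1)!_s}$.
\<close>

lemma s_nabla_surj:
  assumes q: "q \<in> D"
  obtains p where "p \<in> D" "s_nabla R s p = q"
proof -
  define p where "p = (\<lambda>n. case n of 0 \<Rightarrow> \<zero>\<^bsub>L\<^esub> | Suc m \<Rightarrow> coeff P q m \<otimes>\<^bsub>L\<^esub> inv\<^bsub>L\<^esub> \<iota> (s (Suc m)))"
  have q_closed: "q \<in> carrier P" using q by (rule D_carrier)
  have p_closed: "p n \<in> carrier L" for n
    using q_closed \<iota>_s_Units by (auto simp: p_def split: nat.split)
  have "p n = \<zero>\<^bsub>L\<^esub>" if "Suc (deg L q) < n" for n
    using that q_closed \<iota>_s_Units by (auto simp: p_def P.deg_aboveD split: nat.split)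
  then have p_up: "p \<in> carrier P"
    using p_closed by (auto simp: UP_def intro!: mem_upI exI[of _ "Suc (deg L q)"])
  have coeff_p: "coeff P p n = p n" for n
    using p_up by (simp add: UP_def)
  have "p n \<in> inv_fact_span n" for n
  proof (cases n)
    case (Suc m)
    obtain r where r: "r \<in> carrier R" "coeff P q m = \<iota> r \<otimes>\<^bsub>L\<^esub> inv_fact m"
      using coeff_D[OF q, of m] by (auto simp: inv_fact_span_iff)
    have "p n = \<iota> r \<otimes>\<^bsub>L\<^esub> (inv_fact (Suc m) \<otimes>\<^bsub>L\<^esub> \<iota> (s (Suc m))) \<otimes>\<^bsub>L\<^esub> inv\<^bsub>L\<^esub> \<iota> (s (Suc m))"
      by (simp add: p_def Suc r inv_fact_Suc)
    also have "\<dots> = \<iota> r \<otimes>\<^bsub>L\<^esub> inv_fact n"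
      using r s_closed \<iota>_s_Units by (simp add: Suc P.R.m_assoc)
    finally show ?thesis
      using r by (auto simp: inv_fact_span_iff)
  qed (simp add: p_def inv_fact_span_zero)
  then have "p \<in> D"
    using p_up by (simp add: s_divided_ring_eq coeff_p)
  moreover have "s_nabla R s p = q"
  proof (rule P.up_eqI)
    fix n
    show "coeff P (s_nabla R s p) n = coeff P q n"
      using \<iota>_s_Units[of n] p_up q_closed s_closed
      by (simp add: coeff_s_nabla coeff_p) (simp add: p_def P.R.m_assoc)
  qed (use p_up q_closed s_nabla_closed in auto)
  ultimately show ?thesis by (rule that)
qed

text \<open>
  Every $s(n+1)$ is invertible in $R[1/s]$, so only constants are killed. The constants of
  $R\langle x\rangle_s$ are those of \<open>R\<close> because $0!_s = 1$.
\<close>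

lemma s_nabla_kernel:
  "{p \<in> D. s_nabla R s p = \<zero>\<^bsub>P\<^esub>} = (\<lambda>r. monom P (\<iota> r) 0) ` carrier R"
proof (intro equalityI subsetI)
  fix p assume "p \<in> {p \<in> D. s_nabla R s p = \<zero>\<^bsub>P\<^esub>}"
  then have p: "p \<in> D" "p \<in> carrier P" "s_nabla R s p = \<zero>\<^bsub>P\<^esub>"
    by (auto intro: D_carrier)
  have zero: "coeff P p (Suc n) = \<zero>\<^bsub>L\<^esub>" for n
  proof -
    have "coeff P p (Suc n)
        = coeff P p (Suc n) \<otimes>\<^bsub>L\<^esub> \<iota> (s (Suc n)) \<otimes>\<^bsub>L\<^esub> inv\<^bsub>L\<^esub> \<iota> (s (Suc n))"
      using \<iota>_s_Units[of n] p(2) s_closed by (simp add: P.R.m_assoc)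
    also have "coeff P p (Suc n) \<otimes>\<^bsub>L\<^esub> \<iota> (s (Suc n)) = \<zero>\<^bsub>L\<^esub>"
      by (simp add: p(3) flip: coeff_s_nabla[OF p(2)])
    finally show ?thesis
      using \<iota>_s_Units[of n] by simp
  qed
  obtain r where r: "r \<in> carrier R" "coeff P p 0 = \<iota> r"
    using coeff_D[OF p(1), of 0] by (auto simp: inv_fact_span_iff)
  have "p = monom P (\<iota> r) 0"
  proof (rule P.up_eqI)
    fix n show "coeff P p n = coeff P (monom P (\<iota> r) 0) n"
      using r zero by (cases n) auto
  qed (use p r in auto)
  then show "p \<in> (\<lambda>r. monom P (\<iota> r) 0) ` carrier R"
    using r by blast
next
  fix p assume "p \<in> (\<lambda>r. monom P (\<iota> r) 0) ` carrier R"
  then obtain r where r: "r \<in> carrier R" "p = monom P (\<iota> r) 0" by blast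
  then have closed: "p \<in> carrier P" by simp
  have "\<iota> r \<in> inv_fact_span 0"
    using r by (auto simp: inv_fact_span_iff)
  then have "p \<in> D"
    using r by (simp add: s_divided_ring_eq inv_fact_span_zero)
  moreover have "s_nabla R s p = \<zero>\<^bsub>P\<^esub>"
    using closed r s_closed by (intro P.up_eqI) (simp_all add: coeff_s_nabla s_nabla_closed)
  ultimately show "p \<in> {p \<in> D. s_nabla R s p = \<zero>\<^bsub>P\<^esub>}" by simp
qed

end

section \<open>The $s$-de Rham complex and its cohomology\<close>

text \<open>
  The inverse of a bijective linear map is linear. For $H^0$ the map out of \<open>R\<close> is explicit, while
  the required map into \<open>R\<close> is not.
\<close>

lemma module_isomorphicI_inverse:
  assumes "module R N" and g: "g \<in> linear_maps R N M" and bij: "bij_betw g (carrier N) (carrier M)"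
  shows "module_isomorphic R M N"
proof -
  interpret N: module R N by fact
  let ?f = "the_inv_into (carrier N) g"
  have f_bij: "bij_betw ?f (carrier M) (carrier N)"
    by (rule bij_betw_the_inv_into[OF bij])
  have inj: "inj_on g (carrier N)" and im: "g ` carrier N = carrier M"
    using bij by (auto simp: bij_betw_def)
  have fg: "?f (g x) = x" if "x \<in> carrier N" for x
    using the_inv_into_f_f[OF inj that] .
  have add: "?f (g x \<oplus>\<^bsub>M\<^esub> g y) = x \<oplus>\<^bsub>N\<^esub> y" if "x \<in> carrier N" "y \<in> carrier N" for x y
    using g fg[of "x \<oplus>\<^bsub>N\<^esub> y"] that by (simp add: linear_maps_def)
  have smult: "?f (r \<odot>\<^bsub>M\<^esub> g x) = r \<odot>\<^bsub>N\<^esub> x" if "r \<in> carrier R" "x \<in> carrier N" for r x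
    using g fg[of "r \<odot>\<^bsub>N\<^esub> x"] that by (simp add: linear_maps_def)
  have "?f \<in> linear_maps R M N"
    using bij_betw_imp_funcset[OF f_bij]
    by (auto simp: linear_maps_def add smult fg simp flip: im)
  with f_bij show ?thesis
    unfolding module_isomorphic_def by blast
qed

lemma (in cring) module_regular_module: "module R (regular_module R)"
proof (rule moduleI[OF cring_axioms])
  show "abelian_group (regular_module R)"
    by (rule abelian_groupI)
      (auto simp: regular_module_def a_ac intro!: bexI[of _ "\<ominus> _"] l_neg)
qed (auto simp: regular_module_def l_distr r_distr m_assoc)

lemma carrier_quotient_module_self:
  assumes "abelian_group M"
  shows "carrier (quotient_module M (carrier M)) = {carrier M}"
proof -
  interpret abelian_group M by fact
  have "carrier M +>\<^bsub>M\<^esub> a = carrier M" if "a \<in> carrier M" for a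
    unfolding a_r_coset_def using that add.subgroup_self
    by (intro group.coset_join2[OF a_group]) auto
  then show ?thesis
    by (auto simp: quotient_module_def A_RCOSETS_def')
qed

context generalized_n_series begin

abbreviation M where "M \<equiv> s_divided_module R s"

lemma M_simps [simp]:
  "carrier M = D" "zero M = \<zero>\<^bsub>P\<^esub>" "add M = add P" "r \<odot>\<^bsub>M\<^esub> p = \<iota> r \<odot>\<^bsub>P\<^esub> p"
  by (simp_all add: s_divided_module_def)

text \<open>
  The terms of the complex, $R\langle x\rangle_s$ and the zero module, both consist of polynomials over
  $R[1/s]$ with scalars restricted to \<open>R\<close>. It suffices that each is closed under the operations.
\<close>

lemma module_restrict_carrier:
  assumes "H \<subseteq> carrier P" "\<zero>\<^bsub>P\<^esub> \<in> H"
    and "\<And>p. p \<in> H \<Longrightarrow> \<ominus>\<^bsub>P\<^esub> p \<in> H"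
    and "\<And>p q. \<lbrakk>p \<in> H; q \<in> H\<rbrakk> \<Longrightarrow> p \<oplus>\<^bsub>P\<^esub> q \<in> H"
    and "\<And>r p. \<lbrakk>r \<in> carrier R; p \<in> H\<rbrakk> \<Longrightarrow> \<iota> r \<odot>\<^bsub>P\<^esub> p \<in> H"
  shows "module R (M\<lparr>carrier := H\<rparr>)"
proof -
  have H: "p \<in> carrier P" if "p \<in> H" for p
    using that assms(1) by blast
  have "abelian_group (M\<lparr>carrier := H\<rparr>)"
  proof (rule abelian_groupI)
    fix p assume "p \<in> carrier (M\<lparr>carrier := H\<rparr>)"
    then show "\<exists>q\<in>carrier (M\<lparr>carrier := H\<rparr>). q \<oplus>\<^bsub>M\<lparr>carrier := H\<rparr>\<^esub> p = \<zero>\<^bsub>M\<lparr>carrier := H\<rparr>\<^esub>"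
      using assms(3)[of p] H by (intro bexI[of _ "\<ominus>\<^bsub>P\<^esub> p"]) (auto simp: P.P.l_neg)
  qed (use assms H in \<open>auto simp: P.P.a_assoc intro: P.P.a_comm\<close>)
  then show ?thesis
    by (rule moduleI[OF cring_axioms])
      (use assms H in \<open>auto simp: P.UP_smult_l_distr P.UP_smult_r_distr P.UP_smult_assoc1\<close>)
qed

lemma module_D: "module R M"
proof -
  have "module R (M\<lparr>carrier := D\<rparr>)"
    by (rule module_restrict_carrier)
      (auto simp: s_divided_ring_eq inv_fact_span_zero inv_fact_span_neg inv_fact_span_add inv_fact_span_smult)
  then show ?thesis
    by (simp add: s_divided_module_def)
qed

lemma module_zero: "module R (M\<lparr>carrier := {\<zero>\<^bsub>P\<^esub>}\<rparr>)"
proof (rule module_restrict_carrier)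
  fix r p assume "r \<in> carrier R" "p \<in> {\<zero>\<^bsub>P\<^esub>}"
  then show "\<iota> r \<odot>\<^bsub>P\<^esub> p \<in> {\<zero>\<^bsub>P\<^esub>}"
    by (auto intro!: P.up_eqI)
qed auto

lemma module_s_deRham_obj: "module R (s_deRham_obj R s i)"
  by (simp add: s_deRham_obj_def module_D module_zero)

lemma zero_in_D: "\<zero>\<^bsub>P\<^esub> \<in> D"
  by (simp add: s_divided_ring_eq inv_fact_span_zero)

lemma s_nabla_zero: "s_nabla R s \<zero>\<^bsub>P\<^esub> = \<zero>\<^bsub>P\<^esub>"
  using s_closed by (intro P.up_eqI) (simp_all add: coeff_s_nabla s_nabla_closed)

lemma s_nabla_linear: "s_nabla R s \<in> linear_maps R M M"
proof -
  have "s_nabla R s (p \<oplus>\<^bsub>P\<^esub> q) = s_nabla R s p \<oplus>\<^bsub>P\<^esub> s_nabla R s q"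
    if "p \<in> carrier P" "q \<in> carrier P" for p q
    using that s_closed
    by (intro P.up_eqI) (simp_all add: coeff_s_nabla s_nabla_closed P.R.l_distr)
  moreover have "s_nabla R s (\<iota> r \<odot>\<^bsub>P\<^esub> p) = \<iota> r \<odot>\<^bsub>P\<^esub> s_nabla R s p"
    if "r \<in> carrier R" "p \<in> carrier P" for r p
    using that s_closed
    by (intro P.up_eqI) (simp_all add: coeff_s_nabla s_nabla_closed P.R.m_assoc)
  ultimately show ?thesis
    using D_carrier s_nabla_D by (auto simp: linear_maps_def)
qed

lemma cochain_complex_s_deRham: "cochain_complex R (s_deRham_obj R s) (s_deRham_diff R s)"
  unfolding cochain_complex_def
proof (intro conjI allI ballI)
  fix i :: int
  show "module R (s_deRham_obj R s i)" by (rule module_s_deRham_obj)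
  have zero: "(\<lambda>_. \<zero>\<^bsub>P\<^esub>) \<in> linear_maps R (s_deRham_obj R s i) (s_deRham_obj R s (i + 1))"
    using zero_in_D by (auto simp: linear_maps_def s_deRham_obj_def intro!: P.up_eqI)
  show "s_deRham_diff R s i \<in> linear_maps R (s_deRham_obj R s i) (s_deRham_obj R s (i + 1))"
  proof (cases "i = 0")
    case True
    then show ?thesis
      using s_nabla_linear by (simp add: s_deRham_diff_def s_deRham_obj_def)
  qed (use zero in \<open>simp add: s_deRham_diff_def\<close>)
  fix x assume "x \<in> carrier (s_deRham_obj R s i)"
  show "s_deRham_diff R s (i + 1) (s_deRham_diff R s i x) = \<zero>\<^bsub>s_deRham_obj R s (i + 1 + 1)\<^esub>"
    by (auto simp: s_deRham_diff_def s_deRham_obj_def s_nabla_zero)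
qed

lemma cohomology_s_deRham:
  "cohomology (s_deRham_obj R s) (s_deRham_diff R s) i =
    quotient_module
      (M\<lparr>carrier := {x \<in> carrier (s_deRham_obj R s i). s_deRham_diff R s i x = \<zero>\<^bsub>P\<^esub>}\<rparr>)
      (s_deRham_diff R s (i - 1) ` carrier (s_deRham_obj R s (i - 1)))"
  by (simp add: cohomology_def a_kernel_def kernel_def s_deRham_obj_def)

text \<open>
  The only coboundary in degree \<open>0\<close> is zero, so each class of $H^0$ is the singleton of a cocycle,
  and the cocycles are the constants from \<open>R\<close>. Distinct constants stay distinct because \<open>R\<close> embeds
  into $R[1/s]$.
\<close>

lemma cohomology_0_isomorphic:
  "module_isomorphic R (cohomology (s_deRham_obj R s) (s_deRham_diff R s) 0) (regular_module R)"
proof (rule module_isomorphicI_inverse[OF module_regular_module])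
  define c where "c r = monom P (\<iota> r) 0" for r
  let ?K = "M\<lparr>carrier := c ` carrier R\<rparr>"
  let ?H = "cohomology (s_deRham_obj R s) (s_deRham_diff R s) 0"
  let ?g = "\<lambda>r. {c r}"
  have H: "?H = quotient_module ?K {\<zero>\<^bsub>P\<^esub>}"
    using s_nabla_kernel
    by (simp add: cohomology_s_deRham) (simp add: s_deRham_diff_def s_deRham_obj_def c_def)
  have c_closed: "c r \<in> carrier P" if "r \<in> carrier R" for r
    using that by (simp add: c_def)
  have carrier: "carrier ?H = ?g ` carrier R"
    by (auto simp: H quotient_module_def A_RCOSETS_def' a_r_coset_def' c_closed)
  have c_add: "c (a \<oplus> b) = c a \<oplus>\<^bsub>P\<^esub> c b" if "a \<in> carrier R" "b \<in> carrier R" for a b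
    using that by (simp add: c_def)
  have c_mult: "c (a \<otimes> b) = \<iota> a \<odot>\<^bsub>P\<^esub> c b" if "a \<in> carrier R" "b \<in> carrier R" for a b
    using that by (simp add: c_def P.monom_mult_smult del: P.monom_mult)
  show "?g \<in> linear_maps R (regular_module R) ?H"
    unfolding linear_maps_def carrier
    by (auto simp: H quotient_module_def set_add_def' a_r_coset_def' regular_module_def
        c_add c_mult c_closed)
  have "inj_on ?g (carrier R)"
  proof (rule inj_onI)
    fix a b assume ab: "a \<in> carrier R" "b \<in> carrier R" "{c a} = {c b}"
    then have "coeff P (c a) 0 = coeff P (c b) 0" by simp
    then show "a = b"
      using ab inj_on_\<iota> by (simp add: c_def inj_on_def)
  qed
  then show "bij_betw ?g (carrier (regular_module R)) (carrier ?H)"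
    by (simp add: bij_betw_def carrier regular_module_def)
qed

text \<open>
  Outside degree \<open>0\<close> every differential is zero, so every element is a cocycle, and the claim is that
  every element is a coboundary. In degree \<open>1\<close> this is the surjectivity of \<open>s_nabla\<close>; the other terms
  are the zero module.
\<close>

lemma cohomology_vanishes:
  assumes "i \<noteq> 0"
  shows "carrier (cohomology (s_deRham_obj R s) (s_deRham_diff R s) i) =
    {\<zero>\<^bsub>cohomology (s_deRham_obj R s) (s_deRham_diff R s) i\<^esub>}"
proof -
  let ?C = "s_deRham_obj R s" and ?d = "s_deRham_diff R s"
  have cycles: "{x \<in> carrier (?C i). ?d i x = \<zero>\<^bsub>P\<^esub>} = carrier (?C i)"
    using assms by (simp add: s_deRham_diff_def)
  have nabla: "s_nabla R s ` D = D"
    using s_nabla_D s_nabla_surj by blast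
  have boundaries: "?d (i - 1) ` carrier (?C (i - 1)) = carrier (?C i)"
    using assms nabla zero_in_D by (auto simp: s_deRham_diff_def s_deRham_obj_def)
  have "M\<lparr>carrier := carrier (?C i)\<rparr> = ?C i"
    by (simp add: s_deRham_obj_def s_divided_module_def)
  then have "cohomology ?C ?d i = quotient_module (?C i) (carrier (?C i))"
    by (simp add: cohomology_s_deRham cycles boundaries)
  moreover have "abelian_group (?C i)"
    using module_s_deRham_obj[of i] by (rule module.axioms)
  ultimately show ?thesis
    using carrier_quotient_module_self[of "?C i"] by (simp add: quotient_module_def)
qed

end

theorem proposition4p2p1:
  fixes R :: "('a, 'm) ring_scheme" and s :: "nat \<Rightarrow> 'a"
  assumes "generalized_n_series R s"
  shows "cochain_complex R (s_deRham_obj R s) (s_deRham_diff R s) \<and>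
    module_isomorphic R (cohomology (s_deRham_obj R s) (s_deRham_diff R s) 0) (regular_module R) \<and>
    (\<forall>i. i \<noteq> 0 \<longrightarrow>
      carrier (cohomology (s_deRham_obj R s) (s_deRham_diff R s) i) =
        {\<zero>\<^bsub>cohomology (s_deRham_obj R s) (s_deRham_diff R s) i\<^esub>})"
proof -
  interpret generalized_n_series R s by fact
  show ?thesis
    using cochain_complex_s_deRham cohomology_0_isomorphic cohomology_vanishes by blast
qed

end
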